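(* Let $\varphi = \frac{1+\sqrt5}{2}$ and let $F = F_0F_1F_2\cdots$ be the infinite Fibonacci word over $\{0,1\}$. There is an absolute constant $C>0$, independent of $n$, such that for every $n\ge 1$ \[ \left|\, |F[0..n-1]|_1 - \frac{n}{\varphi^2} \,\right| \le C. \] Equivalently, $|F[0..n-1]|_1 = \frac{n}{\varphi^2} + O(1)$ and $|F[0..n-1]|_0 = \frac{n}{\varphi} + O(1)$.
   Context: Let $\varphi = \frac{1+\sqrt5}{2}$, so $\varphi^2=\varphi+1$. The infinite Fibonacci word is $F = (F_k)_{k\ge0} = \lim_{n\to\infty}\sigma^n(0) = 0100101001001\cdots$, where $\sigma$ is the morphism of $\{0,1\}^*$ with $\sigma(0)=01$, $\sigma(1)=0$. Equivalently, $F_k = 0$ if $k+1 = \lfloor m\varphi\rfloor$ for some integer $m\ge 1$, and $F_k = 1$ if $k+1 = \lfloor m\varphi^2\rfloor$ for some integer $m\ge 1$. For $n\ge 1$ let $F[0..n-1] = F_0F_1\cdots F_{n-1}$, $|F[0..n-1]|_1 = \#\{0\le k<n : F_k = 1\}$ and $|F[0..n-1]|_0 = n - |F[0..n-1]|_1$. *)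

theory Defs
  imports Complex_Main "HOL-Library.Landau_Symbols" "HOL-Library.Z2" "HOL-Library.Sublist"
begin

text \<open>The alphabet is the two-element type \<^typ>\<open>bit\<close>; its field structure is not used.\<close>

definition golden :: real (\<open>\<phi>\<close>) where
  "\<phi> = (1 + sqrt 5) / 2"

fun fib_letter :: "bit \<Rightarrow> bit list" where
  "fib_letter a = (if a = 0 then [0, 1] else [0])"

definition fib_morph :: "bit list \<Rightarrow> bit list" where
  "fib_morph w = concat (map fib_letter w)"

text \<open>Convergence of finite words to an infinite word: every position is eventually defined
  and constant.\<close>

definition word_tendsto :: "(nat \<Rightarrow> 'a list) \<Rightarrow> (nat \<Rightarrow> 'a) \<Rightarrow> bool" where
  "word_tendsto W F \<longleftrightarrow> (\<forall>k. \<forall>\<^sub>F n in sequentially. k < length (W n) \<and> W n ! k = F k)"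

definition fib_word :: "nat \<Rightarrow> bit" where
  "fib_word = (THE F. word_tendsto (\<lambda>n. (fib_morph ^^ n) [0]) F)"

definition prefix_ones :: "nat \<Rightarrow> nat" where
  "prefix_ones n = card {k. k < n \<and> fib_word k = 1}"

definition prefix_zeros :: "nat \<Rightarrow> nat" where
  "prefix_zeros n = n - prefix_ones n"

lemma word_tendsto_unique:
  assumes "word_tendsto W F" "word_tendsto W G"
  shows "F = G"
proof
  fix k
  have "\<forall>\<^sub>F n in sequentially. F k = G k"
    using assms[unfolded word_tendsto_def, THEN spec, of k] by eventually_elim auto
  then show "F k = G k" by simp
qed

lemma fib_morph_append: "fib_morph (u @ v) = fib_morph u @ fib_morph v"
  by (simp add: fib_morph_def)

lemma fib_iter_Suc_Suc:
  "(fib_morph ^^ Suc (Suc n)) [0] = (fib_morph ^^ Suc n) [0] @ (fib_morph ^^ n) [0]"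
  by (induction n) (auto simp: fib_morph_append, simp_all add: fib_morph_def)

lemma fib_iter_prefix: "m \<le> n \<Longrightarrow> prefix ((fib_morph ^^ m) [0]) ((fib_morph ^^ n) [0])"
proof (induction n rule: dec_induct)
  case (step n)
  have "prefix ((fib_morph ^^ n) [0]) ((fib_morph ^^ Suc n) [0])"
  proof (cases n)
    case 0
    then show ?thesis by (simp add: fib_morph_def)
  next
    case (Suc i)
    then show ?thesis by (metis fib_iter_Suc_Suc prefixI)
  qed
  with step.IH show ?case by (rule prefix_order.trans)
qed simp

lemma length_fib_iter: "n < length ((fib_morph ^^ n) [0])"
proof (induction n rule: less_induct)
  case (less n)
  consider "n = 0" | "n = 1" | i where "n = Suc (Suc i)"
    by (metis One_nat_def not0_implies_Suc)
  then show ?case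
  proof cases
    case 3
    then have "Suc i < length ((fib_morph ^^ Suc i) [0])" "i < length ((fib_morph ^^ i) [0])"
      by (auto intro!: less.IH simp del: funpow.simps)
    with 3 show ?thesis by (simp only: fib_iter_Suc_Suc length_append)
  qed (simp_all add: fib_morph_def)
qed

lemma fib_word_limit: "word_tendsto (\<lambda>n. (fib_morph ^^ n) [0]) fib_word"
proof -
  define F where "F k = (fib_morph ^^ k) [0] ! k" for k
  have "word_tendsto (\<lambda>n. (fib_morph ^^ n) [0]) F"
    unfolding word_tendsto_def
  proof
    fix k
    have "k < length ((fib_morph ^^ n) [0]) \<and> (fib_morph ^^ n) [0] ! k = F k" if "k \<le> n" for n
      using fib_iter_prefix[OF that] length_fib_iter[of k]
      by (auto simp: F_def prefix_def nth_append)
    then show "\<forall>\<^sub>F n in sequentially.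
        k < length ((fib_morph ^^ n) [0]) \<and> (fib_morph ^^ n) [0] ! k = F k"
      using eventually_sequentially by blast
  qed
  then have "\<exists>!F. word_tendsto (\<lambda>n. (fib_morph ^^ n) [0]) F"
    using word_tendsto_unique by blast
  then show ?thesis
    unfolding fib_word_def by (rule theI')
qed

lemma prefix_zeros_eq_card: "prefix_zeros n = card {k. k < n \<and> fib_word k = 0}"
proof -
  have "{k. k < n \<and> fib_word k = 0} = {..<n} - {k. k < n \<and> fib_word k = 1}"
    by auto
  also have "card \<dots> = card {..<n} - card {k. k < n \<and> fib_word k = 1}"
    by (rule card_Diff_subset) auto
  finally show ?thesis
    by (simp add: prefix_zeros_def prefix_ones_def)
qed

end

theory Submission
  imports Defs
begin

text \<open>
  Give a finite word \<open>w\<close> the discrepancy \<open>D w = |w|\<^sub>1 - |w| / \<phi>\<^sup>2\<close>. It is additive under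
  concatenation, and the vector of its letter values \<open>(D 0, D 1) = (- 1 / \<phi>\<^sup>2, 1 / \<phi>)\<close> is a left
  eigenvector of the incidence matrix of the morphism \<open>\<sigma>\<close> for the eigenvalue \<open>- 1 / \<phi>\<close>, the
  Galois conjugate of \<open>\<phi>\<close>. Hence \<open>D (\<sigma> w) = - D w / \<phi>\<close>: the morphism contracts discrepancies
  (\<open>discrepancy_fib_morph\<close>).

  A prefix of \<open>\<sigma> w\<close> is \<open>\<sigma> q\<close> for a prefix \<open>q\<close> of \<open>w\<close>, possibly followed by a single \<open>0\<close>, the
  first half of a block \<open>01\<close> that has been cut (\<open>prefix_fib_morph\<close>). Desubstitution therefore turns
  a bound \<open>B\<close> for the prefixes of \<open>w\<close> into the bound \<open>B / \<phi> + 1 / \<phi>\<^sup>2\<close> for those of \<open>\<sigma> w\<close>.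
  Since \<open>1 / \<phi> + 1 / \<phi>\<^sup>2 = 1\<close>, the bound \<open>B = 1\<close> reproduces itself, so it holds for the prefixes of
  every iterate \<open>\<sigma>\<^sup>n(0)\<close>, and thus for those of the Fibonacci word.

  The estimate for the zeros is the same one with the opposite sign, again because
  \<open>1 / \<phi> + 1 / \<phi>\<^sup>2 = 1\<close>.
\<close>

lemma golden_pos: "\<phi> > 0"
  by (simp add: golden_def add_pos_nonneg)

lemma golden_square: "\<phi>\<^sup>2 = \<phi> + 1"
  by (simp add: golden_def power2_eq_square field_simps)

lemma inverse_golden_square: "1 / \<phi>\<^sup>2 = 1 - 1 / \<phi>"
proof -
  have "\<phi> * \<phi> = \<phi> + 1"
    using golden_square by (simp add: power2_eq_square)
  then have "\<phi>\<^sup>2 * (1 - 1 / \<phi>) = 1"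
    using golden_pos by (simp add: power2_eq_square field_simps)
  then show ?thesis
    using golden_pos by (simp add: field_simps)
qed

definition discrepancy :: "bit list \<Rightarrow> real" where
  "discrepancy w = real (count_list w 1) - real (length w) / \<phi>\<^sup>2"

lemma discrepancy_Nil [simp]: "discrepancy [] = 0"
  by (simp add: discrepancy_def)

lemma discrepancy_append: "discrepancy (u @ v) = discrepancy u + discrepancy v"
  by (simp add: discrepancy_def add_divide_distrib)

lemma discrepancy_singleton_0: "discrepancy [0] = - (1 / \<phi>\<^sup>2)"
  by (simp add: discrepancy_def)

lemma fib_morph_Cons: "fib_morph (a # w) = fib_letter a @ fib_morph w"
  by (simp add: fib_morph_def)

text \<open>
  By additivity only the two letters matter: the block \<open>01\<close> has discrepancy
  \<open>1 / \<phi> - 1 / \<phi>\<^sup>2 = 1 / \<phi>\<^sup>3\<close> and the block \<open>0\<close> has \<open>- 1 / \<phi>\<^sup>2\<close>, which are \<open>- 1 / \<phi>\<close> times the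
  discrepancies of \<open>0\<close> and of \<open>1\<close>.
\<close>

lemma discrepancy_fib_morph: "discrepancy (fib_morph w) = - discrepancy w / \<phi>"
proof (induction w)
  case Nil
  show ?case by (simp add: fib_morph_def)
next
  case (Cons a w)
  have "discrepancy (fib_letter a) = - discrepancy [a] / \<phi>"
  proof (cases "a = 0")
    case True
    have "discrepancy (fib_letter a) = 1 - 2 / \<phi>\<^sup>2"
      using True by (simp add: discrepancy_def)
    also have "\<dots> = 1 / \<phi> - 1 / \<phi>\<^sup>2"
      using inverse_golden_square by linarith
    also have "\<dots> = (1 - 1 / \<phi>) / \<phi>"
      by (simp add: diff_divide_distrib power2_eq_square)
    also have "\<dots> = (1 / \<phi>\<^sup>2) / \<phi>"
      by (simp only: inverse_golden_square)
    also have "\<dots> = - discrepancy [a] / \<phi>"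
      using True by (simp add: discrepancy_def)
    finally show ?thesis .
  next
    case False
    then have a: "a = 1" by simp
    have "discrepancy (fib_letter a) = - (1 / \<phi>\<^sup>2)"
      using a by (simp add: discrepancy_singleton_0)
    also have "\<dots> = - (1 / \<phi>) / \<phi>"
      by (simp add: power2_eq_square)
    also have "1 / \<phi> = discrepancy [a]"
      using a inverse_golden_square by (simp add: discrepancy_def)
    finally show ?thesis .
  qed
  moreover have "discrepancy (a # w) = discrepancy [a] + discrepancy w"
    using discrepancy_append[of "[a]" w] by simp
  ultimately show ?case
    using Cons.IH by (simp add: fib_morph_Cons discrepancy_append diff_divide_distrib
        del: fib_letter.simps)
qed

text \<open>
  A cut at position \<open>|p|\<close> falls between two blocks or inside one. Blocks have at most two letters
  and both begin with \<open>0\<close>, so whatever remains of a cut block is \<open>0\<close>.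
\<close>

lemma prefix_fib_morph:
  assumes "prefix p (fib_morph w)"
  obtains q where "prefix q w" "p = fib_morph q \<or> p = fib_morph q @ [0]"
proof -
  have "\<exists>q. prefix q w \<and> (p = fib_morph q \<or> p = fib_morph q @ [0])"
    using assms
  proof (induction w arbitrary: p)
    case Nil
    then show ?case by (simp add: fib_morph_def)
  next
    case (Cons a w)
    have "prefix p (fib_letter a) \<or> (\<exists>r. p = fib_letter a @ r \<and> prefix r (fib_morph w))"
      using Cons.prems by (simp only: fib_morph_Cons prefix_append)
    then consider "p = []" | "p = [0]" | r where "p = fib_letter a @ r" "prefix r (fib_morph w)"
      by (auto simp: prefix_Cons split: if_splits)
    then show ?case
    proof cases
      case 1
      then show ?thesis by (intro exI[of _ "[]"]) (simp add: fib_morph_def)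
    next
      case 2
      then show ?thesis by (intro exI[of _ "[]"]) (simp add: fib_morph_def)
    next
      case 3
      then obtain q where "prefix q w" "r = fib_morph q \<or> r = fib_morph q @ [0]"
        using Cons.IH by blast
      then show ?thesis
        using 3 by (intro exI[of _ "a # q"]) (auto simp: fib_morph_Cons)
    qed
  qed
  then show thesis using that by blast
qed

text \<open>
  The constant \<open>1\<close> is the fixed point of \<open>B \<mapsto> B / \<phi> + 1 / \<phi>\<^sup>2\<close>, which is what one
  desubstitution step does to a bound; this is why it serves all iterates at once.
\<close>

lemma discrepancy_prefix_fib_iter:
  assumes "prefix p ((fib_morph ^^ n) [0])"
  shows "\<bar>discrepancy p\<bar> \<le> 1"
  using assms
proof (induction n arbitrary: p)
  case 0
  have "1 / \<phi>\<^sup>2 \<le> 1"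
    using inverse_golden_square golden_pos by simp
  moreover have "p = [] \<or> p = [0]"
    using 0 by (simp add: prefix_Cons)
  ultimately show ?case
    by (auto simp: discrepancy_singleton_0)
next
  case (Suc n)
  then obtain q where q: "prefix q ((fib_morph ^^ n) [0])"
      and p: "p = fib_morph q \<or> p = fib_morph q @ [0]"
    using prefix_fib_morph by (metis comp_apply funpow.simps(2))
  have "\<bar>discrepancy (fib_morph q)\<bar> \<le> 1 / \<phi>"
    using Suc.IH[OF q] golden_pos
    by (simp add: discrepancy_fib_morph divide_right_mono)
  moreover have "0 \<le> 1 / \<phi>\<^sup>2" by simp
  ultimately show ?case
    using p inverse_golden_square
    by (auto simp: discrepancy_append discrepancy_singleton_0)
qed

lemma fib_word_nth:
  assumes "k < length ((fib_morph ^^ n) [0])"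
  shows "(fib_morph ^^ n) [0] ! k = fib_word k"
proof -
  have "\<forall>\<^sub>F m in sequentially. n \<le> m \<and> (fib_morph ^^ m) [0] ! k = fib_word k"
    using fib_word_limit[unfolded word_tendsto_def, THEN spec, of k] eventually_ge_at_top[of n]
    by eventually_elim simp
  then obtain m where "n \<le> m" "(fib_morph ^^ m) [0] ! k = fib_word k"
    using eventually_happens by fastforce
  then show ?thesis
    using fib_iter_prefix[of n m] assms by (auto simp: prefix_def nth_append)
qed

lemma discrepancy_fib_word: "\<bar>real (prefix_ones n) - real n / \<phi>\<^sup>2\<bar> \<le> 1"
proof -
  \<comment> \<open>The \<open>n\<close>-th iterate is longer than \<open>n\<close>, so it contains the prefix of length \<open>n\<close>.\<close>
  define p where "p = take n ((fib_morph ^^ n) [0])"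
  have len: "length p = n"
    using length_fib_iter[of n] by (simp add: p_def)
  have "p ! k = fib_word k" if "k < n" for k
    using that fib_word_nth[of k n] length_fib_iter[of n] by (simp add: p_def)
  then have "{k. k < n \<and> fib_word k = 1} = {k. k < length p \<and> 1 = p ! k}"
    using len by auto
  then have "prefix_ones n = count_list p 1"
    by (simp add: prefix_ones_def count_list_eq_length_filter length_filter_conv_card)
  then show ?thesis
    using discrepancy_prefix_fib_iter[of p n] len
    by (simp add: discrepancy_def p_def take_is_prefix)
qed

theorem theorem3p4:
  shows "(\<exists>C::real. C > 0 \<and> (\<forall>n\<ge>1. \<bar>real (prefix_ones n) - real n / \<phi>\<^sup>2\<bar> \<le> C)) \<and>
    (\<lambda>n. real (prefix_ones n) - real n / \<phi>\<^sup>2) \<in> O(\<lambda>n. 1) \<and>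
    (\<lambda>n. real (prefix_zeros n) - real n / \<phi>) \<in> O(\<lambda>n. 1)"
proof (intro conjI)
  show "\<exists>C::real. C > 0 \<and> (\<forall>n\<ge>1. \<bar>real (prefix_ones n) - real n / \<phi>\<^sup>2\<bar> \<le> C)"
    using discrepancy_fib_word by (intro exI[of _ 1]) simp
  show ones: "(\<lambda>n. real (prefix_ones n) - real n / \<phi>\<^sup>2) \<in> O(\<lambda>n. 1)"
    using discrepancy_fib_word by (intro bigoI[of _ 1]) simp
  have "real (prefix_zeros n) - real n / \<phi> = - (real (prefix_ones n) - real n / \<phi>\<^sup>2)" for n
  proof -
    have "prefix_ones n \<le> card {..<n}"
      unfolding prefix_ones_def by (rule card_mono) auto
    then have "real (prefix_zeros n) = real n - real (prefix_ones n)"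
      by (simp add: prefix_zeros_def)
    moreover have "real n / \<phi>\<^sup>2 = real n - real n / \<phi>"
      using arg_cong[OF inverse_golden_square, of "\<lambda>x. real n * x"]
      by (simp add: right_diff_distrib)
    ultimately show ?thesis by simp
  qed
  then show "(\<lambda>n. real (prefix_zeros n) - real n / \<phi>) \<in> O(\<lambda>n. 1)"
    using ones by (simp only: landau_o.big.uminus_in_iff)
qed

end
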